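(* Let $1<B<2$, $\frac{B^2}{4}<\kappa<\frac12$ and $\beta>0$, and let $h_c^{\mathrm a}=h_c^{\mathrm a}(\beta)$ be the annealed critical point. Then the partition function $Z^{\mathrm a}_{n,h_c^{\mathrm a}}$ does not converge to $1$ as $n\to\infty$; rather, for every integer $n\ge1$, $$\prod_{p=0}^{n-1}Z^{\mathrm a}_{p,h_c^{\mathrm a}}\le\frac{1}{\beta\sqrt\kappa}\left(\frac{B}{2\sqrt\kappa}\right)^{n}.$$ Also, there is a constant $c(B)<\infty$ depending only on $B$ such that for every $n\ge1$ $$\mathbf E^{\mathrm a}_{n,h_c^{\mathrm a}}[S_n]=\mathbf E^{\mathrm a}_{n,h_c^{\mathrm a}}\left[\sum_{i=1}^{2^n}\delta_i\right]\le\frac{c(B)}{\beta}\,\frac{1}{\kappa^{(n+1)/2}}.$$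
   Context: For $n\ge 0$, $\mathbf P_n$ (expectation $\mathbf E_n$) is the law of a random vector $(\delta_1,\dots,\delta_{2^n})\in\{0,1\}^{2^n}$ defined recursively: under $\mathbf P_0$, $\delta_1=1$; under $\mathbf P_{n+1}$, with probability $\frac{B-1}{B}$ all $\delta_i$ are $0$, and with probability $\frac1B$ the two vectors $(\delta_1,\dots,\delta_{2^n})$ and $(\delta_{2^n+1},\dots,\delta_{2^{n+1}})$ are independent, each with law $\mathbf P_n$. Set $S_n=\sum_{i=1}^{2^n}\delta_i$. For $i,j\in\mathbb N=\{1,2,\dots\}$, the hierarchical distance $d(i,j)$ is the smallest $p\ge0$ such that $i$ and $j$ lie in a common block $\{(k-1)2^p+1,\dots,k2^p\}$, $k\in\mathbb N$. Set $\kappa_{ij}=\kappa^{d(i,j)}$ (so $\kappa_{ii}=1$). For $h\in\mathbb R$, the annealed Hamiltonian and partition function are $$H^{\mathrm a}_{n,h}=hS_n+\frac{\beta^2}{2}\sum_{i,j=1}^{2^n}\kappa_{ij}\delta_i\delta_j,\qquad Z^{\mathrm a}_{n,h}=\mathbf E_n\left[e^{H^{\mathrm a}_{n,h}}\right],$$ and $\mathbf E^{\mathrm a}_{n,h}$ is expectation with respect to the probability measure with density $e^{H^{\mathrm a}_{n,h}}/Z^{\mathrm a}_{n,h}$ with respect to $\mathbf P_n$. The annealed free energy is $\mathtt F^{\mathrm a}(\beta,h)=\lim_{n\to\infty}2^{-n}\log Z^{\mathrm a}_{n,h}$ (the limit exists, is finite and non-negative), and the annealed critical point is $h_c^{\mathrm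 a}(\beta)=\sup\{h:\mathtt F^{\mathrm a}(\beta,h)=0\}$, which is finite. *)

theory Defs
  imports "HOL-Probability.Probability"
begin

text \<open>
  A realisation is a function \<open>\<delta>\<close>, where \<open>\<delta> i\<close> for \<open>1 \<le> i \<le> 2 ^ n\<close> are the coordinates
  of the random vector; outside this range \<open>\<delta>\<close> is set to \<open>0\<close>.  In the recursion, the two
  half-vectors are drawn independently and the second one is shifted by \<open>2 ^ n\<close>.
\<close>

primrec hier_law :: "real \<Rightarrow> nat \<Rightarrow> (nat \<Rightarrow> real) pmf" where
  "hier_law B 0 = return_pmf (\<lambda>i. if i = 1 then 1 else 0)"
| "hier_law B (Suc n) =
     bind_pmf (bernoulli_pmf (1 / B)) (\<lambda>b.
       if b then
         map_pmf (\<lambda>(x, y). \<lambda>i. if i \<le> 2 ^ n then x i else y (i - 2 ^ n))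
           (pair_pmf (hier_law B n) (hier_law B n))
       else return_pmf (\<lambda>_. 0))"

definition hier_S :: "nat \<Rightarrow> (nat \<Rightarrow> real) \<Rightarrow> real" where
  "hier_S n \<delta> = (\<Sum>i = 1..2 ^ n. \<delta> i)"

definition hier_block :: "nat \<Rightarrow> nat \<Rightarrow> nat set" where
  "hier_block p k = {(k - 1) * 2 ^ p + 1..k * 2 ^ p}"

definition hier_dist :: "nat \<Rightarrow> nat \<Rightarrow> nat" where
  "hier_dist i j = (LEAST p. \<exists>k\<ge>1. i \<in> hier_block p k \<and> j \<in> hier_block p k)"

definition ann_H :: "real \<Rightarrow> real \<Rightarrow> real \<Rightarrow> nat \<Rightarrow> (nat \<Rightarrow> real) \<Rightarrow> real" where
  "ann_H \<kappa> \<beta> h n \<delta> =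
     h * hier_S n \<delta> +
     \<beta>\<^sup>2 / 2 * (\<Sum>i = 1..2 ^ n. \<Sum>j = 1..2 ^ n. \<kappa> ^ hier_dist i j * \<delta> i * \<delta> j)"

definition ann_Z :: "real \<Rightarrow> real \<Rightarrow> real \<Rightarrow> real \<Rightarrow> nat \<Rightarrow> real" where
  "ann_Z B \<kappa> \<beta> h n = measure_pmf.expectation (hier_law B n) (\<lambda>\<delta>. exp (ann_H \<kappa> \<beta> h n \<delta>))"

definition ann_measure :: "real \<Rightarrow> real \<Rightarrow> real \<Rightarrow> real \<Rightarrow> nat \<Rightarrow> (nat \<Rightarrow> real) measure" where
  "ann_measure B \<kappa> \<beta> h n =
     density (measure_pmf (hier_law B n))
       (\<lambda>\<delta>. ennreal (exp (ann_H \<kappa> \<beta> h n \<delta>) / ann_Z B \<kappa> \<beta> h n))"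

definition ann_E :: "real \<Rightarrow> real \<Rightarrow> real \<Rightarrow> real \<Rightarrow> nat \<Rightarrow> ((nat \<Rightarrow> real) \<Rightarrow> real) \<Rightarrow> real" where
  "ann_E B \<kappa> \<beta> h n f = (\<integral>\<delta>. f \<delta> \<partial>ann_measure B \<kappa> \<beta> h n)"

definition ann_free_energy :: "real \<Rightarrow> real \<Rightarrow> real \<Rightarrow> real \<Rightarrow> real" where
  "ann_free_energy B \<kappa> \<beta> h = lim (\<lambda>n. ln (ann_Z B \<kappa> \<beta> h n) / 2 ^ n)"

definition ann_hc :: "real \<Rightarrow> real \<Rightarrow> real \<Rightarrow> real" where
  "ann_hc B \<kappa> \<beta> = Sup {h. ann_free_energy B \<kappa> \<beta> h = 0}"

end

theory Submission
  imports Defs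
begin

text \<open>
  Cutting \<open>2 ^ (n + 1)\<close> sites into halves turns \<open>H\<close> into the sum of the two half-energies plus the
  cross term \<open>a * S\<^sub>1 * S\<^sub>2\<close> with \<open>a = \<beta>\<^sup>2 * \<kappa> ^ (n + 1)\<close>.  Write \<open>Z = Q + W\<close> for the split of the
  partition function according to \<open>S = 0\<close> or \<open>S > 0\<close>, and \<open>D\<close> for the unnormalised first moment of
  \<open>S\<close>.  Zero free energy forces \<open>Z \<le> 1\<close> at all levels.  From \<open>exp x \<ge> 1 + x\<close> and Cauchy--Schwarz,
  the next value of \<open>D\<close> is at least \<open>(2 / B) * D * (Z + a * D\<^sup>2 / W)\<close>; for \<open>n \<ge> 1\<close> the bracket is at least
  \<open>1\<close> as soon as \<open>a * D\<^sup>2 \<ge> 1 / (4 * B\<^sup>2)\<close>, and then \<open>a * D\<^sup>2\<close> explodes because \<open>4 * \<kappa> > B\<^sup>2\<close>, which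
  contradicts \<open>D \<le> 2 ^ n * Z\<close>.  Hence \<open>a * D\<^sup>2 \<le> 1 / (4 * B\<^sup>2)\<close> wherever the free energy vanishes, and by
  continuity in \<open>h\<close> also at the critical point; this bounds the mean of \<open>S\<close>.  For the product bound,
  an association inequality gives \<open>D / W \<ge> P\<close> with \<open>P = (2 / B) ^ n * (\<Prod>p<n. Z p)\<close>, so
  \<open>sqrt a * P * W \<le> 1 / (2 * B)\<close>; combined with \<open>Q \<le> B - 1\<close> this keeps \<open>sqrt a * P \<le> 1\<close> by
  induction on \<open>n\<close>.
\<close>

subsection \<open>The hierarchical distance\<close>

text \<open>Passing to \<open>i - 1\<close> turns the dyadic blocks into fibres of
  \<open>div\<close>, which makes the distance computable.\<close>

lemma hier_block_iff:
  assumes "i \<ge> 1" "k \<ge> 1"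
  shows "i \<in> hier_block p k \<longleftrightarrow> (i - 1) div 2 ^ p = k - 1"
proof -
  obtain i' k' where ik: "i = Suc i'" "k = Suc k'"
    using assms by (metis One_nat_def Suc_le_D)
  have "i' div 2 ^ p = k' \<longleftrightarrow> k' * 2 ^ p \<le> i' \<and> i' < Suc k' * 2 ^ p"
    by (metis div_nat_eqI div_times_less_eq_dividend dividend_less_times_div mult.commute
        mult_Suc_right pos2 zero_less_power)
  then show ?thesis
    unfolding ik hier_block_def by (simp add: less_Suc_eq_le Suc_le_eq)
qed

lemma hier_dist_eq_Least_div:
  assumes "i \<ge> 1" "j \<ge> 1"
  shows "hier_dist i j = (LEAST p. (i - 1) div 2 ^ p = (j - 1) div 2 ^ p)"
proof -
  have "(\<exists>k\<ge>1. i \<in> hier_block p k \<and> j \<in> hier_block p k) \<longleftrightarrow>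
        (i - 1) div 2 ^ p = (j - 1) div 2 ^ p" for p
  proof
    assume "\<exists>k\<ge>1. i \<in> hier_block p k \<and> j \<in> hier_block p k"
    then show "(i - 1) div 2 ^ p = (j - 1) div 2 ^ p"
      using assms hier_block_iff by auto
  next
    assume *: "(i - 1) div 2 ^ p = (j - 1) div 2 ^ p"
    show "\<exists>k\<ge>1. i \<in> hier_block p k \<and> j \<in> hier_block p k"
      by (rule exI[of _ "Suc ((i - 1) div 2 ^ p)"]) (use * assms hier_block_iff in auto)
  qed
  then show ?thesis
    unfolding hier_dist_def by presburger
qed

lemma hier_dist_commute: "hier_dist i j = hier_dist j i"
  unfolding hier_dist_def by (metis (no_types, lifting))

lemma hier_dist_self: "i \<ge> 1 \<Longrightarrow> hier_dist i i = 0"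
  by (simp add: hier_dist_eq_Least_div)

lemma hier_dist_shift:
  assumes "i \<in> {1..2 ^ n}" "j \<in> {1..2 ^ n}"
  shows "hier_dist (i + 2 ^ n) (j + 2 ^ n) = hier_dist i j"
proof -
  have *: "(i + 2 ^ n - 1) div 2 ^ p = (i - 1) div 2 ^ p + 2 ^ n div 2 ^ p"
    if "i \<in> {1..2 ^ n}" for i p :: nat
  proof (cases "p \<le> n")
    case True
    then have "(2::nat) ^ n = 2 ^ (n - p) * 2 ^ p"
      by (simp flip: power_add)
    moreover have "i + 2 ^ n - 1 = (i - 1) + 2 ^ n"
      using that by auto
    ultimately show ?thesis
      by simp
  next
    case False
    then have "(2::nat) ^ Suc n \<le> 2 ^ p"
      by (intro power_increasing) auto
    moreover from that have "i + 2 ^ n - 1 < 2 ^ Suc n" "i - 1 < 2 ^ Suc n" "(2::nat) ^ n < 2 ^ Suc n"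
      by auto
    ultimately show ?thesis
      by (metis add.right_neutral div_less order_less_le_trans)
  qed
  show ?thesis
    using assms by (simp add: hier_dist_eq_Least_div *[OF assms(1), simplified] *[OF assms(2), simplified])
qed

lemma hier_dist_cross:
  assumes "i \<in> {1..2 ^ n}" "j \<in> {1..2 ^ n}"
  shows "hier_dist i (j + 2 ^ n) = Suc n"
proof -
  have "(LEAST p. (i - 1) div 2 ^ p = (j + 2 ^ n - 1) div 2 ^ p) = Suc n"
  proof (rule Least_equality)
    show "(i - 1) div 2 ^ Suc n = (j + 2 ^ n - 1) div 2 ^ Suc n"
      using assms by (subst (1 2) div_less) auto
  next
    fix p assume p: "(i - 1) div 2 ^ p = (j + 2 ^ n - 1) div 2 ^ p"
    show "Suc n \<le> p"
    proof (rule ccontr)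
      assume "\<not> Suc n \<le> p"
      then have n: "(2::nat) ^ n = 2 ^ p * 2 ^ (n - p)"
        by (simp flip: power_add)
      \<comment> \<open>Agreement at a level \<open>p \<le> n\<close> would persist at level
        \<open>n\<close>, where the two quotients are \<open>0\<close> and at least
        \<open>1\<close>.\<close>
      from p have "(i - 1) div 2 ^ n = (j + 2 ^ n - 1) div 2 ^ n"
        unfolding n by (simp add: div_mult2_eq)
      moreover have "(i - 1) div 2 ^ n = 0"
        using assms by (intro div_less) auto
      moreover have "(j + 2 ^ n - 1) div 2 ^ n \<ge> 1"
      proof -
        have "2 ^ n div 2 ^ n \<le> (j + 2 ^ n - 1) div 2 ^ n"
          using assms by (intro div_le_mono) auto
        then show ?thesis by simp
      qed
      ultimately show False by simp
    qed
  qed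
  then show ?thesis
    using assms by (simp add: hier_dist_eq_Least_div)
qed

section \<open>Splitting a block into its two halves\<close>

lemma sum_split_halves:
  fixes f :: "nat \<Rightarrow> real"
  shows "(\<Sum>i = 1..2 ^ Suc n. f i) = (\<Sum>i = 1..2 ^ n. f i) + (\<Sum>i = 1..2 ^ n. f (i + 2 ^ n))"
proof -
  have "(\<Sum>i = 1..2 ^ Suc n. f i) = (\<Sum>i = 1..2 ^ n. f i) + (\<Sum>i = 2 ^ n + 1..2 ^ n + 2 ^ n. f i)"
    using sum.ub_add_nat[of 1 "2 ^ n" f "2 ^ n"] by (simp add: mult_2)
  also have "(\<Sum>i = 2 ^ n + 1..2 ^ n + 2 ^ n. f i) = (\<Sum>i = 1..2 ^ n. f (i + 2 ^ n))"
    using sum.shift_bounds_cl_nat_ivl[of f 1 "2 ^ n" "2 ^ n"] by (simp add: add.commute)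
  finally show ?thesis .
qed

definition hier_join :: "nat \<Rightarrow> (nat \<Rightarrow> real) \<Rightarrow> (nat \<Rightarrow> real) \<Rightarrow> nat \<Rightarrow> real" where
  "hier_join n x y = (\<lambda>i. if i \<le> 2 ^ n then x i else y (i - 2 ^ n))"

lemma hier_S_join: "hier_S (Suc n) (hier_join n x y) = hier_S n x + hier_S n y"
  unfolding hier_S_def sum_split_halves
  by (intro arg_cong2[of _ _ _ _ "(+)"] sum.cong) (auto simp: hier_join_def)

text \<open>All cross pairs have distance \<open>n + 1\<close>; each is counted in both orders,
  which cancels the \<open>1 / 2\<close> in front of the double sum.\<close>

lemma ann_H_join:
  "ann_H \<kappa> \<beta> h (Suc n) (hier_join n x y) =
     ann_H \<kappa> \<beta> h n x + ann_H \<kappa> \<beta> h n y + \<beta>\<^sup>2 * \<kappa> ^ Suc n * hier_S n x * hier_S n y"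
proof -
  define z where "z = hier_join n x y"
  define U where "U = (\<lambda>x::nat \<Rightarrow> real. \<Sum>i = 1..2 ^ n. \<Sum>j = 1..2 ^ n. \<kappa> ^ hier_dist i j * x i * x j)"
  have z1: "z i = x i" if "i \<in> {1..2 ^ n}" for i
    using that by (simp add: z_def hier_join_def)
  have z2: "z (i + 2 ^ n) = y i" if "i \<in> {1..2 ^ n}" for i
    using that by (simp add: z_def hier_join_def)
  have 11: "(\<Sum>i = 1..2 ^ n. \<Sum>j = 1..2 ^ n. \<kappa> ^ hier_dist i j * z i * z j) = U x"
    unfolding U_def by (intro sum.cong refl) (simp add: z1)
  have 22: "(\<Sum>i = 1..2 ^ n. \<Sum>j = 1..2 ^ n.
      \<kappa> ^ hier_dist (i + 2 ^ n) (j + 2 ^ n) * z (i + 2 ^ n) * z (j + 2 ^ n)) = U y"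
    unfolding U_def by (intro sum.cong refl) (simp add: z2 hier_dist_shift)
  have 12: "(\<Sum>i = 1..2 ^ n. \<Sum>j = 1..2 ^ n. \<kappa> ^ hier_dist i (j + 2 ^ n) * z i * z (j + 2 ^ n))
      = \<kappa> ^ Suc n * (hier_S n x * hier_S n y)"
    unfolding hier_S_def sum_product unfolding sum_distrib_left
    by (intro sum.cong refl) (simp add: z1 z2 hier_dist_cross)
  have 21: "(\<Sum>i = 1..2 ^ n. \<Sum>j = 1..2 ^ n. \<kappa> ^ hier_dist (i + 2 ^ n) j * z (i + 2 ^ n) * z j)
      = \<kappa> ^ Suc n * (hier_S n y * hier_S n x)"
    unfolding hier_S_def sum_product unfolding sum_distrib_left
    by (intro sum.cong refl) (simp add: z1 z2 hier_dist_cross hier_dist_commute[of "_ + 2 ^ n"])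
  have "(\<Sum>i = 1..2 ^ Suc n. \<Sum>j = 1..2 ^ Suc n. \<kappa> ^ hier_dist i j * z i * z j)
      = U x + U y + 2 * \<kappa> ^ Suc n * (hier_S n x * hier_S n y)"
    unfolding sum_split_halves sum.distrib 11 12 21 22 by (simp add: algebra_simps)
  then show ?thesis
    unfolding ann_H_def z_def[symmetric] U_def
    by (simp add: hier_S_join z_def algebra_simps)
qed

lemma hier_S_zero: "hier_S n (\<lambda>_. 0) = 0"
  by (simp add: hier_S_def)

lemma ann_H_zero: "ann_H \<kappa> \<beta> h n (\<lambda>_. 0) = 0"
  by (simp add: ann_H_def hier_S_def)

subsection \<open>The law of the hierarchical model\<close>

lemma finite_set_hier_law [simp]: "finite (set_pmf (hier_law B n))"
  by (induction n) (auto simp: if_distrib)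

lemma set_hier_law_Suc_cases:
  assumes "z \<in> set_pmf (hier_law B (Suc n))"
  obtains "z = (\<lambda>_. 0)"
    | x y where "x \<in> set_pmf (hier_law B n)" "y \<in> set_pmf (hier_law B n)" "z = hier_join n x y"
  using assms by (auto simp: hier_join_def split: if_splits)

lemma hier_S_bounds:
  assumes "z \<in> set_pmf (hier_law B n)"
  shows "0 \<le> hier_S n z \<and> hier_S n z \<le> 2 ^ n"
  using assms
proof (induction n arbitrary: z)
  case 0
  then show ?case by (simp add: hier_S_def)
next
  case (Suc n)
  from Suc.prems show ?case
  proof (cases rule: set_hier_law_Suc_cases)
    case (2 x y)
    then show ?thesis
      using Suc.IH[of x] Suc.IH[of y] by (simp add: hier_S_join)
  qed (simp add: hier_S_zero)
qed

text \<open>A site has \<open>2 ^ (p - 1)\<close> partners at distance \<open>p \<ge> 1\<close>, so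
  its total interaction is dominated by a geometric series, summable because
  \<open>\<kappa> < 1 / 2\<close>.\<close>

lemma ann_H_le:
  assumes "z \<in> set_pmf (hier_law B n)" "0 < \<kappa>" "\<kappa> < 1 / 2"
  shows "ann_H \<kappa> \<beta> h n z \<le> (h + \<beta>\<^sup>2 / 2 * (1 + \<kappa> / (1 - 2 * \<kappa>))) * hier_S n z"
proof -
  \<comment> \<open>This is the partial sum up to distance \<open>n\<close>, which the induction
    needs; the full series replaces it only at the end.\<close>
  define c where "c n = \<beta>\<^sup>2 / 2 * (1 + \<kappa> * (1 - (2 * \<kappa>) ^ n) / (1 - 2 * \<kappa>))" for n
  have c_Suc: "c (Suc n) = c n + \<beta>\<^sup>2 / 2 * \<kappa> ^ Suc n * 2 ^ n" for n
  proof -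
    have "1 - (2 * \<kappa>) ^ Suc n = 1 - (2 * \<kappa>) ^ n + (2 * \<kappa>) ^ n * (1 - 2 * \<kappa>)"
      by (simp add: algebra_simps)
    then have "(1 - (2 * \<kappa>) ^ Suc n) / (1 - 2 * \<kappa>) = (1 - (2 * \<kappa>) ^ n) / (1 - 2 * \<kappa>) + (2 * \<kappa>) ^ n"
      using assms by (simp only: add_divide_distrib) simp
    then have "c (Suc n) = \<beta>\<^sup>2 / 2 * (1 + \<kappa> * ((1 - (2 * \<kappa>) ^ n) / (1 - 2 * \<kappa>) + (2 * \<kappa>) ^ n))"
      unfolding c_def by (simp only: times_divide_eq_right[symmetric])
    then show ?thesis
      unfolding c_def by (simp add: algebra_simps power_mult_distrib)
  qed
  have "ann_H \<kappa> \<beta> h n z \<le> (h + c n) * hier_S n z"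
    using assms(1)
  proof (induction n arbitrary: z)
    case 0
    then show ?case
      by (simp add: ann_H_def hier_S_def c_def hier_dist_self)
  next
    case (Suc n)
    from Suc.prems show ?case
    proof (cases rule: set_hier_law_Suc_cases)
      case 1
      then show ?thesis by (simp add: ann_H_zero hier_S_zero)
    next
      case (2 x y)
      define s t where "s = hier_S n x" and "t = hier_S n y"
      have st: "0 \<le> s" "s \<le> 2 ^ n" "0 \<le> t" "t \<le> 2 ^ n"
        using 2 hier_S_bounds by (auto simp: s_def t_def)
      \<comment> \<open>Each half has at most \<open>2 ^ n\<close> ones, so the bilinear cross term
        is bounded linearly in \<open>s + t\<close>.\<close>
      have "s * t \<le> 2 ^ n * t" "s * t \<le> s * 2 ^ n"
        using st by (auto intro: mult_right_mono mult_left_mono)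
      then have "2 * (s * t) \<le> 2 ^ n * (s + t)"
        by (simp add: algebra_simps)
      then have "\<beta>\<^sup>2 * \<kappa> ^ Suc n / 2 * (2 * (s * t)) \<le> \<beta>\<^sup>2 * \<kappa> ^ Suc n / 2 * (2 ^ n * (s + t))"
        using assms by (intro mult_left_mono) auto
      moreover have "ann_H \<kappa> \<beta> h n x \<le> (h + c n) * s" "ann_H \<kappa> \<beta> h n y \<le> (h + c n) * t"
        using 2 Suc.IH by (auto simp: s_def t_def)
      ultimately show ?thesis
        unfolding 2 ann_H_join hier_S_join c_Suc s_def[symmetric] t_def[symmetric]
        by (simp add: distrib_left distrib_right)
    qed
  qed
  moreover have "c n \<le> \<beta>\<^sup>2 / 2 * (1 + \<kappa> / (1 - 2 * \<kappa>))"
    unfolding c_def using assms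
    by (intro mult_left_mono add_left_mono divide_right_mono) (auto simp: algebra_simps)
  ultimately show ?thesis
    using hier_S_bounds[OF assms(1)]
    by (meson add_left_mono mult_right_mono order_trans)
qed

lemma expectation_hier_law_eq_sum:
  "measure_pmf.expectation (hier_law B n) f =
     (\<Sum>x\<in>set_pmf (hier_law B n). pmf (hier_law B n) x * f x)" for f :: "_ \<Rightarrow> real"
  by (subst integral_measure_pmf[of "set_pmf (hier_law B n)"]) auto

lemma expectation_hier_law_Suc:
  fixes f :: "(nat \<Rightarrow> real) \<Rightarrow> real"
  assumes "1 < B"
  shows "measure_pmf.expectation (hier_law B (Suc n)) f =
     (B - 1) / B * f (\<lambda>_. 0) +
     1 / B * (\<Sum>x\<in>set_pmf (hier_law B n). \<Sum>y\<in>set_pmf (hier_law B n).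
        pmf (hier_law B n) x * pmf (hier_law B n) y * f (hier_join n x y))"
proof -
  define p where "p = hier_law B n"
  have fin: "finite (set_pmf p)" by (simp add: p_def)
  have law: "hier_law B (Suc n) = bind_pmf (bernoulli_pmf (1 / B)) (\<lambda>b.
     if b then map_pmf (\<lambda>(x, y). hier_join n x y) (pair_pmf p p) else return_pmf (\<lambda>_. 0))"
    unfolding hier_law.simps hier_join_def[abs_def] p_def ..
  have "measure_pmf.expectation (hier_law B (Suc n)) f =
     1 / B * measure_pmf.expectation (map_pmf (\<lambda>(x, y). hier_join n x y) (pair_pmf p p)) f
     + (1 - 1 / B) * f (\<lambda>_. 0)"
    unfolding law using assms fin
    by (subst pmf_expectation_bind[of UNIV]) (auto simp: UNIV_bool)
  also have "measure_pmf.expectation (map_pmf (\<lambda>(x, y). hier_join n x y) (pair_pmf p p)) f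
     = measure_pmf.expectation (pair_pmf p p) (\<lambda>(x, y). f (hier_join n x y))"
    by (simp add: case_prod_unfold)
  also have "\<dots> = (\<Sum>z\<in>set_pmf p \<times> set_pmf p. pmf (pair_pmf p p) z *\<^sub>R (case z of (x, y) \<Rightarrow> f (hier_join n x y)))"
    using fin by (intro integral_measure_pmf) auto
  also have "\<dots> = (\<Sum>x\<in>set_pmf p. \<Sum>y\<in>set_pmf p. pmf p x * pmf p y * f (hier_join n x y))"
    unfolding sum.cartesian_product by (intro sum.cong refl) (auto simp: pmf_pair)
  finally show ?thesis
    using assms by (simp add: p_def field_simps)
qed


subsection \<open>Correlation inequalities for weighted finite sums\<close>

text \<open>To be instantiated with the support of \<open>hier_law B n\<close>, its tilted weights,
  \<open>hier_S n\<close> and the coupling of the two halves.\<close>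

context
  fixes A :: "'a set" and \<mu> s :: "'a \<Rightarrow> real" and a :: real
  assumes fin: "finite A"
    and \<mu>_nonneg: "\<And>x. x \<in> A \<Longrightarrow> 0 \<le> \<mu> x"
    and s_nonneg: "\<And>x. x \<in> A \<Longrightarrow> 0 \<le> s x"
    and a_nonneg: "0 \<le> a"
begin

abbreviation (input) "wZ \<equiv> \<Sum>x\<in>A. \<mu> x"
abbreviation (input) "wD \<equiv> \<Sum>x\<in>A. \<mu> x * s x"
abbreviation (input) "wE \<equiv> \<Sum>x\<in>A. \<mu> x * (s x)\<^sup>2"
abbreviation (input) "wW \<equiv> \<Sum>x\<in>A. \<mu> x * of_bool (s x > 0)"
abbreviation (input) "wQ \<equiv> \<Sum>x\<in>A. \<mu> x * of_bool (s x = 0)"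
text \<open>Up to the factor \<open>1 / B\<close>, \<open>wG\<close> is the next-level mass with
  both halves nonempty and \<open>wDD\<close> the next-level first moment.\<close>

abbreviation (input) "wG \<equiv> \<Sum>x\<in>A. \<Sum>y\<in>A. \<mu> x * \<mu> y *
  (of_bool (s x > 0) * of_bool (s y > 0) * exp (a * s x * s y))"
abbreviation (input) "wDD \<equiv> \<Sum>x\<in>A. \<Sum>y\<in>A. \<mu> x * \<mu> y * ((s x + s y) * exp (a * s x * s y))"

lemma exp_cross_ge_1: "x \<in> A \<Longrightarrow> y \<in> A \<Longrightarrow> 1 \<le> exp (a * s x * s y)"
  using s_nonneg a_nonneg by simp

lemma weight_split: "wZ = wQ + wW"
proof -
  have "\<mu> x = \<mu> x * of_bool (s x = 0) + \<mu> x * of_bool (s x > 0)" if "x \<in> A" for x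
    using s_nonneg[OF that] by auto
  then show ?thesis
    unfolding sum.distrib[symmetric] by (intro sum.cong) auto
qed

lemma cross_weight_zero:
  "(\<Sum>x\<in>A. \<Sum>y\<in>A. \<mu> x * \<mu> y * (of_bool (s x + s y = 0) * exp (a * s x * s y))) = wQ\<^sup>2"
  unfolding power2_eq_square sum_product
  by (intro sum.cong refl) (auto dest!: s_nonneg)

lemma cross_weight_pos:
  "(\<Sum>x\<in>A. \<Sum>y\<in>A. \<mu> x * \<mu> y * (of_bool (s x + s y > 0) * exp (a * s x * s y)))
     = 2 * wQ * wW + wG"
proof -
  have "(\<Sum>x\<in>A. \<Sum>y\<in>A. \<mu> x * \<mu> y * (of_bool (s x + s y > 0) * exp (a * s x * s y))) =
    (\<Sum>x\<in>A. \<Sum>y\<in>A. (\<mu> x * of_bool (s x = 0)) * (\<mu> y * of_bool (s y > 0))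
      + (\<mu> x * of_bool (s x > 0)) * (\<mu> y * of_bool (s y = 0))
      + \<mu> x * \<mu> y * (of_bool (s x > 0) * of_bool (s y > 0) * exp (a * s x * s y)))"
    by (intro sum.cong refl) (auto dest!: s_nonneg)
  also have "\<dots> = wQ * wW + wW * wQ + wG"
    by (simp only: sum.distrib sum_product)
  finally show ?thesis by simp
qed

lemma cross_weight_ge_square: "wG \<ge> wW\<^sup>2"
  unfolding power2_eq_square sum_product
proof (intro sum_mono)
  fix x y assume "x \<in> A" "y \<in> A"
  then have "\<mu> x * \<mu> y * 1 \<le> \<mu> x * \<mu> y * exp (a * s x * s y)"
    by (intro mult_left_mono mult_nonneg_nonneg exp_cross_ge_1 \<mu>_nonneg)
  then show "\<mu> x * of_bool (s x > 0) * (\<mu> y * of_bool (s y > 0)) \<le>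
      \<mu> x * \<mu> y * (of_bool (s x > 0) * of_bool (s y > 0) * exp (a * s x * s y))"
    by auto
qed

text \<open>Replacing \<open>exp x\<close> by \<open>1 + x\<close> makes the double sum factor into
  single moments.\<close>

lemma cross_moment_ge: "wDD \<ge> 2 * wD * (wZ + a * wE)"
proof -
  have "2 * wD * (wZ + a * wE) = wD * wZ + wZ * wD + a * (wE * wD) + a * (wD * wE)"
    by (simp add: algebra_simps)
  also have "\<dots> = (\<Sum>x\<in>A. \<Sum>y\<in>A. \<mu> x * \<mu> y * ((s x + s y) * (1 + a * s x * s y)))"
    unfolding sum_product unfolding sum_distrib_left sum.distrib[symmetric]
    by (intro sum.cong refl) (simp add: algebra_simps power2_eq_square)
  also have "\<dots> \<le> wDD"
    by (intro sum_mono mult_left_mono exp_ge_add_one_self) (auto simp: \<mu>_nonneg s_nonneg)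
  finally show ?thesis .
qed

text \<open>Cauchy--Schwarz against the indicator of \<open>s > 0\<close> gives the factor
  \<open>wW\<close> instead of the larger \<open>wZ\<close>.\<close>

lemma moment_square_le: "wD\<^sup>2 \<le> wE * wW"
proof -
  have "wD = (\<Sum>x\<in>A. (sqrt (\<mu> x) * s x) * (sqrt (\<mu> x) * of_bool (s x > 0)))"
  proof (intro sum.cong refl)
    fix x assume "x \<in> A"
    then have "sqrt (\<mu> x) * sqrt (\<mu> x) = \<mu> x" "s x * of_bool (s x > 0) = s x"
      using \<mu>_nonneg s_nonneg[of x] by auto
    then show "\<mu> x * s x = (sqrt (\<mu> x) * s x) * (sqrt (\<mu> x) * of_bool (s x > 0))"
      by (metis mult.assoc mult.left_commute)
  qed
  also have "\<dots>\<^sup>2 \<le> (\<Sum>x\<in>A. (sqrt (\<mu> x) * s x)\<^sup>2) * (\<Sum>x\<in>A. (sqrt (\<mu> x) * of_bool (s x > 0))\<^sup>2)"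
    by (rule Cauchy_Schwarz_ineq_sum)
  also have "(\<Sum>x\<in>A. (sqrt (\<mu> x) * s x)\<^sup>2) = wE"
    by (intro sum.cong refl) (simp add: power_mult_distrib \<mu>_nonneg)
  also have "(\<Sum>x\<in>A. (sqrt (\<mu> x) * of_bool (s x > 0))\<^sup>2) = wW"
    by (intro sum.cong refl) (simp add: power_mult_distrib \<mu>_nonneg)
  finally show ?thesis .
qed

text \<open>Chebyshev's association inequality, applied to the increasing functions \<open>t\<close> and
  \<open>g t = (\<Sum>y\<in>A. \<mu> y * of_bool (s y > 0) * exp (a * t * s y))\<close> of \<open>t = s x\<close>.\<close>

lemma cross_moment_association: "wW * wDD \<ge> 2 * wD * (wQ * wW + wG)"
proof -
  define g where "g t = (\<Sum>y\<in>A. \<mu> y * of_bool (s y > 0) * exp (a * t * s y))" for t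
  define u where "u x = (of_bool (s x > 0) :: real)" for x
  define K where "K = (\<Sum>x\<in>A. \<mu> x * s x * g (s x))"
  have G: "wG = (\<Sum>x\<in>A. \<mu> x * u x * g (s x))"
    unfolding g_def u_def sum_distrib_left by (intro sum.cong refl) (simp add: ac_simps)
  have K: "K = (\<Sum>x\<in>A. \<Sum>y\<in>A. \<mu> x * s x * (\<mu> y * of_bool (s y > 0) * exp (a * s x * s y)))"
    unfolding K_def g_def sum_distrib_left ..
  have K': "K = (\<Sum>x\<in>A. \<Sum>y\<in>A. \<mu> y * s y * (\<mu> x * of_bool (s x > 0) * exp (a * s y * s x)))"
    unfolding K by (rule sum.swap)
  have "wDD = (\<Sum>x\<in>A. \<Sum>y\<in>A. (\<mu> x * s x) * (\<mu> y * of_bool (s y = 0))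
      + (\<mu> x * of_bool (s x = 0)) * (\<mu> y * s y)
      + (\<mu> x * s x * (\<mu> y * of_bool (s y > 0) * exp (a * s x * s y)))
      + \<mu> y * s y * (\<mu> x * of_bool (s x > 0) * exp (a * s y * s x)))"
    by (intro sum.cong refl) (auto dest!: s_nonneg simp: algebra_simps)
  also have "\<dots> = wD * wQ + wQ * wD + K + K"
    by (simp only: sum.distrib sum_product K[symmetric] K'[symmetric])
  finally have DD: "wDD = 2 * wQ * wD + 2 * K" by simp
  have g_mono: "g t \<le> g t'" if "t \<le> t'" for t t'
    unfolding g_def using that \<mu>_nonneg s_nonneg a_nonneg
    by (intro sum_mono mult_left_mono) (auto intro!: mult_right_mono mult_left_mono)
  \<comment> \<open>The first factor is \<open>s x - s y\<close> if both values are positive and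
    vanishes otherwise, so monotonicity of \<open>g\<close> decides the sign.\<close>
  have pos: "(s x * u y - s y * u x) * (g (s x) - g (s y)) \<ge> 0" if "x \<in> A" "y \<in> A" for x y
  proof (cases "s x > 0 \<and> s y > 0")
    case True
    then show ?thesis
      using g_mono[of "s x" "s y"] g_mono[of "s y" "s x"]
      by (cases "s x \<le> s y") (auto simp: u_def mult_nonpos_nonpos)
  next
    case False
    then show ?thesis
      using s_nonneg[OF that(1)] s_nonneg[OF that(2)] by (auto simp: u_def)
  qed
  have "0 \<le> (\<Sum>x\<in>A. \<Sum>y\<in>A. \<mu> x * \<mu> y * ((s x * u y - s y * u x) * (g (s x) - g (s y))))"
    by (intro sum_nonneg mult_nonneg_nonneg pos \<mu>_nonneg)
  also have "\<dots> = (\<Sum>x\<in>A. \<Sum>y\<in>A. (\<mu> x * s x * g (s x)) * (\<mu> y * u y) + (\<mu> x * u x) * (\<mu> y * s y * g (s y))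
      - (\<mu> x * u x * g (s x)) * (\<mu> y * s y) - (\<mu> x * s x) * (\<mu> y * u y * g (s y)))"
    by (intro sum.cong refl) (simp add: algebra_simps)
  also have "\<dots> = K * wW + wW * K - wG * wD - wD * wG"
    by (simp only: sum.distrib sum_subtractf sum_product K_def G u_def)
  finally have "wD * wG \<le> wW * K" by (simp add: algebra_simps)
  then show ?thesis
    unfolding DD by (simp add: algebra_simps)
qed

end

subsection \<open>Moments of the tilted model\<close>

definition tilted :: "real \<Rightarrow> real \<Rightarrow> real \<Rightarrow> real \<Rightarrow> nat \<Rightarrow> (real \<Rightarrow> real) \<Rightarrow> real" where
  "tilted B \<kappa> \<beta> h n f =
     measure_pmf.expectation (hier_law B n) (\<lambda>\<delta>. f (hier_S n \<delta>) * exp (ann_H \<kappa> \<beta> h n \<delta>))"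

definition tilted_weight :: "real \<Rightarrow> real \<Rightarrow> real \<Rightarrow> real \<Rightarrow> nat \<Rightarrow> (nat \<Rightarrow> real) \<Rightarrow> real" where
  "tilted_weight B \<kappa> \<beta> h n \<delta> = pmf (hier_law B n) \<delta> * exp (ann_H \<kappa> \<beta> h n \<delta>)"

lemma tilted_eq_sum:
  "tilted B \<kappa> \<beta> h n f =
     (\<Sum>x\<in>set_pmf (hier_law B n). tilted_weight B \<kappa> \<beta> h n x * f (hier_S n x))"
  unfolding tilted_def tilted_weight_def expectation_hier_law_eq_sum
  by (intro sum.cong refl) (simp add: ac_simps)

lemma tilted_Suc:
  assumes "1 < B"
  shows "tilted B \<kappa> \<beta> h (Suc n) f = (B - 1) / B * f 0 + 1 / B *
    (\<Sum>x\<in>set_pmf (hier_law B n). \<Sum>y\<in>set_pmf (hier_law B n).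
       tilted_weight B \<kappa> \<beta> h n x * tilted_weight B \<kappa> \<beta> h n y *
       (f (hier_S n x + hier_S n y) * exp (\<beta>\<^sup>2 * \<kappa> ^ Suc n * hier_S n x * hier_S n y)))"
  unfolding tilted_def expectation_hier_law_Suc[OF assms] tilted_weight_def
    hier_S_join ann_H_join hier_S_zero ann_H_zero
  by (simp add: exp_add ac_simps)

lemma tilted_0: "tilted B \<kappa> \<beta> h 0 f = f 1 * exp (h + \<beta>\<^sup>2 / 2)"
  by (simp add: tilted_def hier_S_def ann_H_def hier_dist_self)

text \<open>A finite sum of exponentials in \<open>h\<close>; this later carries bounds to the
  critical point.\<close>

lemma continuous_tilted: "continuous_on UNIV (\<lambda>h. tilted B \<kappa> \<beta> h n f)"
  unfolding tilted_eq_sum tilted_weight_def ann_H_def by (intro continuous_intros)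

lemma ann_E_hier_S:
  "ann_E B \<kappa> \<beta> h n (hier_S n) = tilted B \<kappa> \<beta> h n (\<lambda>s. s) / ann_Z B \<kappa> \<beta> h n"
proof -
  have "ann_Z B \<kappa> \<beta> h n \<ge> 0"
    unfolding ann_Z_def by (intro integral_nonneg_AE) auto
  then have "ann_E B \<kappa> \<beta> h n (hier_S n) =
    measure_pmf.expectation (hier_law B n)
      (\<lambda>\<delta>. (exp (ann_H \<kappa> \<beta> h n \<delta>) / ann_Z B \<kappa> \<beta> h n) *\<^sub>R hier_S n \<delta>)"
    unfolding ann_E_def ann_measure_def by (intro integral_density) auto
  then show ?thesis
    unfolding tilted_def by (simp add: ac_simps)
qed

subsection \<open>Recursions for the moments\<close>

locale hier_pinning =
  fixes B \<kappa> \<beta> :: real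
  assumes B: "1 < B" "B < 2" and \<kappa>: "B\<^sup>2 / 4 < \<kappa>" "\<kappa> < 1 / 2" and \<beta>: "0 < \<beta>"
begin

definition Z :: "real \<Rightarrow> nat \<Rightarrow> real" where "Z h n = tilted B \<kappa> \<beta> h n (\<lambda>_. 1)"
definition D :: "real \<Rightarrow> nat \<Rightarrow> real" where "D h n = tilted B \<kappa> \<beta> h n (\<lambda>s. s)"
definition E :: "real \<Rightarrow> nat \<Rightarrow> real" where "E h n = tilted B \<kappa> \<beta> h n (\<lambda>s. s\<^sup>2)"
definition W :: "real \<Rightarrow> nat \<Rightarrow> real" where "W h n = tilted B \<kappa> \<beta> h n (\<lambda>s. of_bool (s > 0))"
definition Q :: "real \<Rightarrow> nat \<Rightarrow> real" where "Q h n = tilted B \<kappa> \<beta> h n (\<lambda>s. of_bool (s = 0))"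
definition a :: "nat \<Rightarrow> real" where "a n = \<beta>\<^sup>2 * \<kappa> ^ Suc n"
definition G :: "real \<Rightarrow> nat \<Rightarrow> real" where
  "G h n = (\<Sum>x\<in>set_pmf (hier_law B n). \<Sum>y\<in>set_pmf (hier_law B n).
     tilted_weight B \<kappa> \<beta> h n x * tilted_weight B \<kappa> \<beta> h n y *
     (of_bool (hier_S n x > 0) * of_bool (hier_S n y > 0) * exp (a n * hier_S n x * hier_S n y)))"

lemma \<kappa>_gt: "1 / 4 < \<kappa>"
proof -
  have "1\<^sup>2 < B\<^sup>2" using B by (intro power_strict_mono) auto
  then show ?thesis using \<kappa> by simp
qed

lemma \<kappa>_pos: "0 < \<kappa>"
  using \<kappa>_gt by simp

lemma a_pos: "0 < a n"
  using \<kappa>_pos \<beta> by (simp add: a_def)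

lemma a_Suc: "a (Suc n) = \<kappa> * a n"
  by (simp add: a_def)

lemma ann_Z_eq: "ann_Z B \<kappa> \<beta> h n = Z h n"
  by (simp add: ann_Z_def Z_def tilted_def)

lemma tilted_weight_nonneg: "0 \<le> tilted_weight B \<kappa> \<beta> h n x"
  by (simp add: tilted_weight_def)

lemma hier_S_nonneg: "x \<in> set_pmf (hier_law B n) \<Longrightarrow> 0 \<le> hier_S n x"
  using hier_S_bounds by blast

lemma a_nonneg: "0 \<le> a n"
  using a_pos less_imp_le by blast

lemmas weighted_sums =
  weight_split cross_weight_zero cross_weight_pos cross_weight_ge_square cross_moment_ge
  moment_square_le cross_moment_association

lemmas hier_sums = weighted_sums[where A = "set_pmf (hier_law B n)"
    and \<mu> = "tilted_weight B \<kappa> \<beta> h n" and s = "hier_S n" and a = "a n",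
    OF finite_set_hier_law tilted_weight_nonneg hier_S_nonneg a_nonneg] for h n

lemma Z_0: "Z h 0 = exp (h + \<beta>\<^sup>2 / 2)"
  and D_0: "D h 0 = Z h 0" and E_0: "E h 0 = Z h 0" and W_0: "W h 0 = Z h 0" and Q_0: "Q h 0 = 0"
  by (simp_all add: Z_def D_def E_def W_def Q_def tilted_0)

lemma Z_eq_Q_plus_W: "Z h n = Q h n + W h n"
  unfolding Z_def Q_def W_def tilted_eq_sum mult_1_right
  by (rule hier_sums(1))

lemma tilted_Suc_a:
  "tilted B \<kappa> \<beta> h (Suc n) f = (B - 1) / B * f 0 + 1 / B *
    (\<Sum>x\<in>set_pmf (hier_law B n). \<Sum>y\<in>set_pmf (hier_law B n).
       tilted_weight B \<kappa> \<beta> h n x * tilted_weight B \<kappa> \<beta> h n y *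
       (f (hier_S n x + hier_S n y) * exp (a n * hier_S n x * hier_S n y)))"
  using B by (simp add: tilted_Suc a_def)

lemma Q_Suc: "Q h (Suc n) = (B - 1 + (Q h n)\<^sup>2) / B"
  using hier_sums(2)[of n h]
  unfolding Q_def tilted_Suc_a tilted_eq_sum[of _ _ _ _ n] by (simp add: add_divide_distrib)

lemma W_Suc: "W h (Suc n) = (2 * Q h n * W h n + G h n) / B"
  using hier_sums(3)[of n h]
  unfolding W_def Q_def G_def tilted_Suc_a tilted_eq_sum[of _ _ _ _ n] by simp

lemma G_ge: "(W h n)\<^sup>2 \<le> G h n"
  unfolding W_def G_def tilted_eq_sum
  by (rule hier_sums(4))

lemma E_nonneg: "0 \<le> E h n"
  unfolding E_def tilted_eq_sum by (intro sum_nonneg mult_nonneg_nonneg tilted_weight_nonneg) auto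

lemma D_square_le: "(D h n)\<^sup>2 \<le> E h n * W h n"
  unfolding D_def E_def W_def tilted_eq_sum
  by (rule hier_sums(6))

lemma D_Suc_ge: "D h (Suc n) \<ge> 2 / B * D h n * (Z h n + a n * E h n)"
  using mult_left_mono[OF hier_sums(5)[of n h], of "1 / B"] B
  unfolding D_def E_def Z_def tilted_Suc_a tilted_eq_sum[of _ _ _ _ n] by simp

lemma W_D_Suc_ge: "W h n * D h (Suc n) \<ge> 2 / B * D h n * (Q h n * W h n + G h n)"
  using mult_left_mono[OF hier_sums(7)[of n h], of "1 / B"] B
  unfolding D_def W_def Q_def G_def tilted_Suc_a tilted_eq_sum[of _ _ _ _ n] by simp

lemma D_le: "D h n \<le> 2 ^ n * Z h n"
  unfolding D_def Z_def tilted_eq_sum sum_distrib_left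
proof (intro sum_mono)
  fix x assume "x \<in> set_pmf (hier_law B n)"
  then show "tilted_weight B \<kappa> \<beta> h n x * hier_S n x \<le> 2 ^ n * (tilted_weight B \<kappa> \<beta> h n x * 1)"
    using mult_left_mono[OF conjunct2[OF hier_S_bounds] tilted_weight_nonneg] by (simp add: mult.commute)
qed

text \<open>The map \<open>q \<mapsto> (B - 1 + q\<^sup>2) / B\<close> is increasing for
  \<open>q \<ge> 0\<close> and fixes \<open>B - 1\<close>, and \<open>Q\<close> starts at
  \<open>0\<close>.\<close>

lemma Q_nonneg: "0 \<le> Q h n" and Q_le: "Q h n \<le> B - 1"
proof -
  have "0 \<le> Q h n \<and> Q h n \<le> B - 1"
  proof (induction n)
    case (Suc n)
    then have "(Q h n)\<^sup>2 \<le> (B - 1)\<^sup>2"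
      by (intro power_mono) auto
    then have "(Q h n)\<^sup>2 + (B - 1) \<le> (B - 1) * B"
      by (simp add: power2_eq_square algebra_simps)
    then show ?case
      using B by (simp add: Q_Suc pos_divide_le_eq add.commute)
  qed (use B in \<open>simp add: Q_0\<close>)
  then show "0 \<le> Q h n" "Q h n \<le> B - 1" by auto
qed

text \<open>The top-level coin alone empties the block with this probability; level \<open>0\<close>
  has no coin.\<close>

lemma Q_ge: "n \<ge> 1 \<Longrightarrow> (B - 1) / B \<le> Q h n"
  using B by (cases n) (auto simp: Q_Suc divide_right_mono)

lemma W_pos: "0 < W h n"
proof (induction n)
  case (Suc n)
  then have "0 < G h n"
    using G_ge[of h n] by (smt (verit) zero_less_power2)
  then show ?case
    unfolding W_Suc using B Suc Q_nonneg[of h n] by (intro divide_pos_pos add_nonneg_pos) auto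
qed (simp add: W_0 Z_0)

lemma Z_pos: "0 < Z h n"
  unfolding Z_eq_Q_plus_W using W_pos Q_nonneg by (intro add_nonneg_pos)

lemma D_pos: "0 < D h n"
proof (induction n)
  case (Suc n)
  then have "0 < 2 / B * D h n * (Z h n + a n * E h n)"
    using B Z_pos[of h n] a_pos[of n] E_nonneg[of h n]
    by (intro mult_pos_pos add_pos_nonneg) auto
  then show ?case using D_Suc_ge by (rule less_le_trans)
qed (simp add: D_0 Z_0)

text \<open>Dropping the coupling between the halves, that is \<open>G \<ge> W\<^sup>2\<close>,
  leaves the recursion of the model without interaction.\<close>

lemma Z_Suc_ge: "(B - 1 + (Z h n)\<^sup>2) / B \<le> Z h (Suc n)"
proof -
  have "Z h (Suc n) = (B - 1 + (Q h n)\<^sup>2 + 2 * Q h n * W h n + G h n) / B"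
    by (simp add: Z_eq_Q_plus_W Q_Suc W_Suc add_divide_distrib)
  also have "\<dots> \<ge> (B - 1 + (Q h n)\<^sup>2 + 2 * Q h n * W h n + (W h n)\<^sup>2) / B"
    using B G_ge by (intro divide_right_mono) auto
  finally show ?thesis
    by (simp add: Z_eq_Q_plus_W power2_sum algebra_simps)
qed

subsection \<open>The free energy\<close>

text \<open>A bound on the interaction energy per occupied site, uniform in the level; at
  \<open>h = - K\<close> the energy is therefore nonpositive.\<close>

definition K :: real where "K = \<beta>\<^sup>2 / 2 * (1 + \<kappa> / (1 - 2 * \<kappa>))"

lemma ann_H_le_K:
  "x \<in> set_pmf (hier_law B n) \<Longrightarrow> ann_H \<kappa> \<beta> h n x \<le> (h + K) * hier_S n x"
  unfolding K_def using ann_H_le \<kappa>_pos \<kappa> by blast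

lemma Z_le_exp:
  assumes "\<And>x. x \<in> set_pmf (hier_law B n) \<Longrightarrow> ann_H \<kappa> \<beta> h n x \<le> c"
  shows "Z h n \<le> exp c"
proof -
  have "Z h n = (\<Sum>x\<in>set_pmf (hier_law B n). pmf (hier_law B n) x * exp (ann_H \<kappa> \<beta> h n x))"
    by (simp add: Z_def tilted_eq_sum tilted_weight_def)
  also have "\<dots> \<le> (\<Sum>x\<in>set_pmf (hier_law B n). pmf (hier_law B n) x * exp c)"
    using assms by (intro sum_mono mult_left_mono) auto
  also have "\<dots> = exp c"
    by (simp add: sum_distrib_right[symmetric] sum_pmf_eq_1)
  finally show ?thesis .
qed

text \<open>Since \<open>Z (Suc n) \<ge> Z n ^ 2 / B\<close>, the sequence \<open>ln (Z n / B) / 2 ^ n\<close> is increasing.\<close>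

lemma
  shows free_energy_limit: "(\<lambda>n. ln (Z h n) / 2 ^ n) \<longlonglongrightarrow> ann_free_energy B \<kappa> \<beta> h"
    and free_energy_ge: "ln (Z h n / B) / 2 ^ n \<le> ann_free_energy B \<kappa> \<beta> h"
proof -
  define L where "L n = ln (Z h n / B) / 2 ^ n" for n
  have ln_L: "ln (Z h n / B) = ln (Z h n) - ln B" for n
    using B Z_pos[of h n] by (simp add: ln_div)
  have "L n \<le> L (Suc n)" for n
  proof -
    have "(Z h n / B)\<^sup>2 \<le> Z h (Suc n) / B"
    proof -
      have "(Z h n)\<^sup>2 / B \<le> (B - 1 + (Z h n)\<^sup>2) / B"
        using B by (intro divide_right_mono) auto
      then have "(Z h n)\<^sup>2 / B / B \<le> Z h (Suc n) / B"
        using Z_Suc_ge B by (intro divide_right_mono) (auto intro: order_trans)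
      then show ?thesis by (simp add: power2_eq_square)
    qed
    then have "ln ((Z h n / B)\<^sup>2) \<le> ln (Z h (Suc n) / B)"
      using Z_pos[of h n] B by (intro ln_mono) auto
    then have "2 * ln (Z h n / B) \<le> ln (Z h (Suc n) / B)"
      using Z_pos[of h n] B by (simp add: ln_realpow)
    then have "2 * ln (Z h n / B) / 2 ^ Suc n \<le> ln (Z h (Suc n) / B) / 2 ^ Suc n"
      by (intro divide_right_mono) auto
    then show ?thesis by (simp add: L_def)
  qed
  then have inc: "incseq L" by (rule incseq_SucI)
  have "L n \<le> \<bar>h + K\<bar>" for n
  proof -
    have "Z h n \<le> exp (\<bar>h + K\<bar> * 2 ^ n)"
    proof (rule Z_le_exp)
      fix x assume x: "x \<in> set_pmf (hier_law B n)"
      have "ann_H \<kappa> \<beta> h n x \<le> (h + K) * hier_S n x"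
        using x by (rule ann_H_le_K)
      also have "\<dots> \<le> \<bar>h + K\<bar> * 2 ^ n"
        using hier_S_bounds[OF x] by (intro mult_mono) auto
      finally show "ann_H \<kappa> \<beta> h n x \<le> \<bar>h + K\<bar> * 2 ^ n" .
    qed
    then have "ln (Z h n) \<le> \<bar>h + K\<bar> * 2 ^ n"
      using Z_pos[of h n] by (simp flip: ln_le_cancel_iff)
    moreover have "0 \<le> ln B" using B by simp
    ultimately show ?thesis
      unfolding L_def ln_L by (simp add: pos_divide_le_eq)
  qed
  then obtain l where l: "L \<longlonglongrightarrow> l" "\<And>n. L n \<le> l"
    using incseq_convergent[OF inc] by blast
  have "(\<lambda>n. L n + ln B * (1 / 2) ^ n) \<longlonglongrightarrow> l + ln B * 0"
    by (intro tendsto_intros l LIMSEQ_realpow_zero) auto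
  moreover have "(\<lambda>n. L n + ln B * (1 / 2) ^ n) = (\<lambda>n. ln (Z h n) / 2 ^ n)"
    by (auto simp: L_def ln_L power_one_over field_simps)
  ultimately have lim: "(\<lambda>n. ln (Z h n) / 2 ^ n) \<longlonglongrightarrow> l" by simp
  then have "ann_free_energy B \<kappa> \<beta> h = l"
    unfolding ann_free_energy_def ann_Z_eq by (rule limI)
  then show "(\<lambda>n. ln (Z h n) / 2 ^ n) \<longlonglongrightarrow> ann_free_energy B \<kappa> \<beta> h"
    and "ln (Z h n / B) / 2 ^ n \<le> ann_free_energy B \<kappa> \<beta> h"
    using lim l(2)[of n] by (simp_all add: L_def)
qed

text \<open>The fixed point \<open>1\<close> of \<open>x \<mapsto> (B - 1 + x\<^sup>2) / B\<close> is repelling with slope \<open>2 / B > 1\<close>, so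
  \<open>Z h n > 1\<close> forces \<open>Z h m > B\<close> for some \<open>m\<close>, hence positive free energy.\<close>

lemma Z_le_1_if_free_energy_0:
  assumes "ann_free_energy B \<kappa> \<beta> h = 0"
  shows "Z h n \<le> 1"
proof (rule ccontr)
  assume "\<not> Z h n \<le> 1"
  then have gt: "Z h n - 1 > 0" by simp
  have grow: "(2 / B) ^ k * (Z h n - 1) \<le> Z h (n + k) - 1" for k
  proof (induction k)
    case (Suc k)
    have "0 < (2 / B) ^ k * (Z h n - 1)" using gt B by simp
    with Suc have "1 \<le> Z h (n + k)" by linarith
    have "(2 / B) ^ Suc k * (Z h n - 1) = 2 / B * ((2 / B) ^ k * (Z h n - 1))" by simp
    also have "\<dots> \<le> 2 / B * (Z h (n + k) - 1)"
      using Suc B by (intro mult_left_mono) auto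
    \<comment> \<open>Anticipates the factorisation
      \<open>(x\<^sup>2 - 1) / B = (x + 1) / B * (x - 1)\<close>.\<close>
    also have "\<dots> \<le> (Z h (n + k) + 1) / B * (Z h (n + k) - 1)"
      using \<open>1 \<le> Z h (n + k)\<close> B by (intro mult_right_mono divide_right_mono) auto
    also have "\<dots> = (B - 1 + (Z h (n + k))\<^sup>2) / B - 1"
      using B by (simp add: field_simps power2_eq_square)
    also have "\<dots> \<le> Z h (n + Suc k) - 1"
      using Z_Suc_ge[of h "n + k"] by simp
    finally show ?case .
  qed simp
  obtain k where "B / (Z h n - 1) < (2 / B) ^ k"
    using B real_arch_pow[of "2 / B"] by auto
  then have "B < (2 / B) ^ k * (Z h n - 1)"
    using gt by (simp add: pos_divide_less_eq)
  with grow[of k] have "B < Z h (n + k)" by linarith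
  then have "0 < ln (Z h (n + k) / B) / 2 ^ (n + k)"
    using B by (intro divide_pos_pos ln_gt_zero) auto
  with free_energy_ge[of h "n + k"] assms show False by linarith
qed

text \<open>Here \<open>Z\<close> stays between \<open>(B - 1) / B\<close> and \<open>1\<close> for
  \<open>n \<ge> 1\<close>. This makes the set defining the critical point nonempty.\<close>

lemma free_energy_0_at_minus_K: "ann_free_energy B \<kappa> \<beta> (- K) = 0"
proof -
  have le: "Z (- K) n \<le> 1" for n
    using Z_le_exp[of n "- K" 0] ann_H_le_K[of _ n "- K"] by auto
  have ge: "ln ((B - 1) / B) \<le> ln (Z (- K) n)" if "n \<ge> 1" for n
    using B Q_ge[OF that, of "- K"] W_pos[of "- K" n] Z_pos[of "- K" n]
    by (subst ln_le_cancel_iff) (auto simp: Z_eq_Q_plus_W)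
  have z: "(\<lambda>n. ln ((B - 1) / B) * (1 / 2) ^ n) \<longlonglongrightarrow> ln ((B - 1) / B) * 0"
    by (intro tendsto_intros LIMSEQ_realpow_zero) auto
  have "(\<lambda>n. ln (Z (- K) n) / 2 ^ n) \<longlonglongrightarrow> 0"
  proof (rule tendsto_sandwich[where h = "\<lambda>_. 0"])
    show "\<forall>\<^sub>F n in sequentially. ln ((B - 1) / B) * (1 / 2) ^ n \<le> ln (Z (- K) n) / 2 ^ n"
      using eventually_ge_at_top[of 1]
    proof eventually_elim
      case (elim n)
      then show ?case
        using divide_right_mono[OF ge[OF elim], of "2 ^ n"] by (simp add: power_one_over)
    qed
    show "\<forall>\<^sub>F n in sequentially. ln (Z (- K) n) / 2 ^ n \<le> 0"
      using le Z_pos by (intro always_eventually allI divide_nonpos_pos) auto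
  qed (use z in auto)
  with free_energy_limit show ?thesis by (rule LIMSEQ_unique)
qed

subsection \<open>Explosion of the first moment\<close>

text \<open>The witness is the bracket \<open>Z + a * E\<close>; it is at least \<open>1\<close>
  once \<open>a * E\<close> makes up for the deficit \<open>1 - Z\<close>.\<close>

lemma explosion_step:
  assumes Z: "Z h n \<le> 1" and n: "n \<ge> 1" and X: "1 / (4 * B\<^sup>2) \<le> a n * (D h n)\<^sup>2"
  obtains v where "1 \<le> v" "a n * (D h n)\<^sup>2 \<le> v"
    "4 * \<kappa> / B\<^sup>2 * (a n * (D h n)\<^sup>2) * v\<^sup>2 \<le> a (Suc n) * (D h (Suc n))\<^sup>2"
proof
  let ?X = "a n * (D h n)\<^sup>2" and ?v = "Z h n + a n * E h n"
  have aE: "0 \<le> a n * E h n"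
    using a_pos[of n] E_nonneg[of h n] by simp
  have XW: "?X \<le> a n * E h n * W h n"
    using mult_left_mono[OF D_square_le less_imp_le[OF a_pos]] by (simp add: mult.assoc)
  have W: "W h n \<le> 1 / B - (1 - Z h n)"
    using Q_ge[OF n, of h] B by (simp add: Z_eq_Q_plus_W diff_divide_distrib)
  have "a n * E h n * W h n \<le> a n * E h n * 1"
  proof (rule mult_left_mono[OF _ aE])
    have "1 / B \<le> 1" using B by simp
    then show "W h n \<le> 1" using W Z by linarith
  qed
  then show "?X \<le> ?v"
    using XW Z_pos[of h n] by linarith
  \<comment> \<open>The parabola \<open>u * (1 / B - u)\<close> peaks at
    \<open>u = 1 / (2 * B)\<close>; its maximum is the threshold
    \<open>1 / (4 * B\<^sup>2)\<close>.\<close>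
  have "(1 - Z h n) * W h n \<le> (1 - Z h n) * (1 / B - (1 - Z h n))"
    using W Z by (intro mult_left_mono) auto
  also have "\<dots> = 1 / (4 * B\<^sup>2) - (1 - Z h n - 1 / (2 * B))\<^sup>2"
    using B by (simp add: power2_eq_square field_simps)
  also have "\<dots> \<le> 1 / (4 * B\<^sup>2)" by simp
  finally have "(1 - Z h n) * W h n \<le> a n * E h n * W h n"
    using X XW by linarith
  then show v: "1 \<le> ?v"
    using W_pos[of h n] by simp
  have "4 * \<kappa> / B\<^sup>2 * ?X * ?v\<^sup>2 = a (Suc n) * (2 / B * D h n * ?v)\<^sup>2"
    by (simp add: a_Suc power_mult_distrib power_divide)
  also have "\<dots> \<le> a (Suc n) * (D h (Suc n))\<^sup>2"
    using D_Suc_ge a_pos D_pos[of h n] v B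
    by (intro mult_left_mono power_mono) (auto simp: less_imp_le)
  finally show "4 * \<kappa> / B\<^sup>2 * ?X * ?v\<^sup>2 \<le> a (Suc n) * (D h (Suc n))\<^sup>2" .
qed

text \<open>Above the threshold \<open>a n * (D h n)\<^sup>2\<close> grows geometrically, and once it exceeds \<open>2\<close> it is at
  least quadrupled in each step, against the trivial bound \<open>\<beta>\<^sup>2 * 2 ^ n\<close>.\<close>

lemma no_explosion:
  assumes Z: "\<And>n. Z h n \<le> 1" and n: "n \<ge> 1"
  shows "a n * (D h n)\<^sup>2 \<le> 1 / (4 * B\<^sup>2)"
proof (rule ccontr)
  define X where "X n = a n * (D h n)\<^sup>2" for n
  define g where "g = 4 * \<kappa> / B\<^sup>2"
  have g: "1 < g"
    using \<kappa> B by (simp add: g_def pos_less_divide_eq)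
  have X_pos: "0 < X m" for m
    using a_pos[of m] D_pos[of h m] by (simp add: X_def)
  have step: "g * X m \<le> X (Suc m)" "X m ^ 3 \<le> X (Suc m)"
    if m: "m \<ge> 1" "1 / (4 * B\<^sup>2) \<le> X m" for m
  proof -
    obtain v where v: "1 \<le> v" "X m \<le> v" "g * X m * v\<^sup>2 \<le> X (Suc m)"
      using explosion_step[OF Z m(1)] m(2) unfolding X_def g_def by blast
    have "g * X m * 1 \<le> g * X m * v\<^sup>2"
      using v(1) g X_pos[of m] by (intro mult_left_mono) auto
    with v(3) show "g * X m \<le> X (Suc m)" by simp
    have "1 * X m * (X m)\<^sup>2 \<le> g * X m * v\<^sup>2"
      using v g X_pos[of m] by (intro mult_mono power_mono) auto
    with v(3) show "X m ^ 3 \<le> X (Suc m)" by (simp add: power2_eq_square power3_eq_cube)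
  qed
  assume "\<not> a n * (D h n)\<^sup>2 \<le> 1 / (4 * B\<^sup>2)"
  then have Xn: "1 / (4 * B\<^sup>2) \<le> X n" by (simp add: X_def)
  have geometric: "g ^ k * X n \<le> X (n + k) \<and> 1 / (4 * B\<^sup>2) \<le> X (n + k)" for k
  proof (induction k)
    case (Suc k)
    have s: "g * X (n + k) \<le> X (n + Suc k)"
      using step(1)[of "n + k"] Suc n by simp
    have "g * (g ^ k * X n) \<le> g * X (n + k)" "1 * X (n + k) \<le> g * X (n + k)"
      using Suc g X_pos[of "n + k"] by (auto intro: mult_left_mono mult_right_mono)
    then show ?case using s Suc by (auto simp: mult.assoc)
  qed (use Xn in simp)
  \<comment> \<open>The target \<open>2\<close> is where \<open>x ^ 3 \<ge> 4 * x\<close> begins to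
    hold.\<close>
  obtain k0 where "2 / X n < g ^ k0"
    using g real_arch_pow by blast
  then have "2 \<le> X (n + k0)"
    using geometric[of k0] X_pos[of n] by (simp add: pos_divide_less_eq)
  define m where "m = n + k0"
  have m: "m \<ge> 1" "2 \<le> X m" using n \<open>2 \<le> X (n + k0)\<close> by (auto simp: m_def)
  have quadruple: "2 * 4 ^ k \<le> X (m + k)" for k
  proof (induction k)
    case (Suc k)
    have "1 \<le> (4::real) ^ k" by simp
    with Suc have X2: "2 \<le> X (m + k)" by linarith
    moreover have "1 / (4 * B\<^sup>2) \<le> X (m + k)"
      using geometric[of "k0 + k"] by (simp add: m_def add.assoc)
    ultimately have "X (m + k) ^ 3 \<le> X (m + Suc k)"
      using step(2)[of "m + k"] m by simp
    moreover have "2\<^sup>2 * X (m + k) \<le> (X (m + k))\<^sup>2 * X (m + k)"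
      using X2 by (intro mult_right_mono power_mono) auto
    ultimately show ?case
      using Suc by (simp add: power2_eq_square power3_eq_cube)
  qed (use m in simp)
  \<comment> \<open>Since \<open>4 * \<kappa> < 2\<close>, the trivial bound on \<open>D\<close>
    lets \<open>X\<close> at most double per step, too slow for quadrupling.\<close>
  have upper: "X j \<le> \<beta>\<^sup>2 * 2 ^ j" for j
  proof -
    have "D h j \<le> 2 ^ j * 1"
      using D_le Z by (rule order_trans[OF _ mult_left_mono]) simp
    then have "(D h j)\<^sup>2 \<le> (2 ^ j)\<^sup>2"
      using D_pos[of h j] by (intro power_mono) auto
    then have "X j \<le> a j * (2 ^ j)\<^sup>2"
      unfolding X_def using a_pos by (intro mult_left_mono) (auto simp: less_imp_le)
    also have "\<dots> = \<beta>\<^sup>2 * \<kappa> * ((4 * \<kappa>) ^ j)"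
    proof -
      have "((2::real) ^ j)\<^sup>2 = 4 ^ j"
        unfolding power2_eq_square by (simp flip: power_mult_distrib)
      then show ?thesis by (simp add: a_def power_mult_distrib)
    qed
    also have "\<dots> \<le> \<beta>\<^sup>2 * 1 * (2 ^ j)"
      using \<kappa>_pos \<kappa> \<beta> by (intro mult_mono power_mono) auto
    finally show ?thesis by simp
  qed
  obtain k where k: "\<beta>\<^sup>2 * 2 ^ m < 2 ^ k"
    using real_arch_pow[of 2 "\<beta>\<^sup>2 * 2 ^ m"] by auto
  have "(2::real) ^ k * 2 ^ k = 4 ^ k"
    by (simp flip: power_mult_distrib)
  then have "2 * (2 ^ k * 2 ^ k) \<le> \<beta>\<^sup>2 * 2 ^ m * 2 ^ k"
    using quadruple[of k] upper[of "m + k"] by (simp add: power_add mult.assoc)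
  then have "2 * 2 ^ k \<le> \<beta>\<^sup>2 * 2 ^ m"
    by simp
  moreover have "(0::real) < 2 ^ k" by simp
  ultimately show False using k by linarith
qed

subsection \<open>The critical point\<close>

abbreviation (input) "hc \<equiv> ann_hc B \<kappa> \<beta>"

text \<open>Membership in the closure suffices: closed conditions on \<open>h\<close> pass to the
  supremum without knowing the free energy there. Level \<open>0\<close> bounds the set
  above.\<close>

lemma hc_in_closure: "hc \<in> closure {h. ann_free_energy B \<kappa> \<beta> h = 0}"
  unfolding ann_hc_def
proof (rule closure_contains_Sup)
  show "{h. ann_free_energy B \<kappa> \<beta> h = 0} \<noteq> {}"
    using free_energy_0_at_minus_K by blast
  show "bdd_above {h. ann_free_energy B \<kappa> \<beta> h = 0}"
  proof (rule bdd_aboveI)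
    fix h assume "h \<in> {h. ann_free_energy B \<kappa> \<beta> h = 0}"
    then have "Z h 0 \<le> 1" by (simp add: Z_le_1_if_free_energy_0)
    then show "h \<le> - (\<beta>\<^sup>2 / 2)" by (simp add: Z_0)
  qed
qed

lemma continuous_Z: "continuous_on UNIV (\<lambda>h. Z h n)"
  unfolding Z_def by (rule continuous_tilted)

lemma Z_hc_le_1: "Z hc n \<le> 1"
proof -
  have "closure {h. ann_free_energy B \<kappa> \<beta> h = 0} \<subseteq> {h. Z h n \<le> 1}"
    by (intro closure_minimal closed_Collect_le continuous_on_const continuous_Z)
       (auto simp: Z_le_1_if_free_energy_0)
  with hc_in_closure show ?thesis by blast
qed

lemma D_hc_le:
  assumes "n \<ge> 1"
  shows "\<beta> * sqrt \<kappa> ^ Suc n * D hc n \<le> 1 / (2 * B)"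
proof (rule power2_le_imp_le)
  have "(\<beta> * sqrt \<kappa> ^ Suc n * D hc n)\<^sup>2 = a n * (D hc n)\<^sup>2"
  proof -
    have "(sqrt \<kappa> ^ Suc n)\<^sup>2 = \<kappa> ^ Suc n"
      using \<kappa>_pos by (metis less_imp_le mult.commute power_mult real_sqrt_pow2)
    then show ?thesis unfolding a_def power_mult_distrib by simp
  qed
  also have "\<dots> \<le> (1 / (2 * B))\<^sup>2"
    using no_explosion[OF Z_hc_le_1 assms] by (simp add: power_divide power_mult_distrib)
  finally show "(\<beta> * sqrt \<kappa> ^ Suc n * D hc n)\<^sup>2 \<le> (1 / (2 * B))\<^sup>2" .
qed (use B in simp)

section \<open>The product of partition functions as a lower bound for the conditional mean\<close>

definition P :: "real \<Rightarrow> nat \<Rightarrow> real" where "P h n = (2 / B) ^ n * (\<Prod>p<n. Z h p)"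

lemma P_pos: "0 < P h n"
  unfolding P_def using B Z_pos by (intro mult_pos_pos prod_pos) auto

lemma P_Suc: "P h (Suc n) = 2 / B * Z h n * P h n"
  by (simp add: P_def)

text \<open>The conditional mean \<open>D / W\<close> of \<open>S\<close> given \<open>S > 0\<close> grows in each step at least by the factor
  \<open>2 / B * Z\<close>, because \<open>Z * (2 * Q * W + G) \<le> B * (Q * W + G)\<close>: as \<open>Z \<le> B\<close>, the worst case is
  \<open>G = W\<^sup>2\<close>, where the inequality reads \<open>Z + Q \<le> B\<close>.\<close>

lemma P_W_le_D:
  assumes "\<And>n. Z h n \<le> 1"
  shows "P h n * W h n \<le> D h n"
proof (induction n)
  case 0
  show ?case by (simp add: P_def W_0 D_0)
next
  case (Suc n)
  let ?z = "Z h n" and ?q = "Q h n" and ?w = "W h n" and ?g = "G h n"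
  have w: "0 < ?w" by (rule W_pos)
  have "B * (?q * ?w + ?g) - ?z * (2 * ?q * ?w + ?g) =
      ?w * ?z * (B - (?z + ?q)) + (B - ?z) * (?g - ?w\<^sup>2)"
    unfolding Z_eq_Q_plus_W by (simp add: power2_eq_square algebra_simps)
  \<comment> \<open>\<open>Z \<le> 1\<close> and \<open>Q \<le> B - 1\<close> give
    \<open>Z + Q \<le> B\<close>.\<close>
  also have "\<dots> \<ge> 0"
    using w Z_pos[of h n] assms[of n] Q_le[of h n] G_ge[of h n] B
    by (intro add_nonneg_nonneg mult_nonneg_nonneg) auto
  finally have "?z * (2 * ?q * ?w + ?g) \<le> B * (?q * ?w + ?g)" by simp
  then have *: "?z * W h (Suc n) \<le> ?q * ?w + ?g"
    unfolding W_Suc using B by (simp add: pos_divide_le_eq mult.commute)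
  have qg: "0 \<le> ?q * ?w + ?g"
    using w Q_nonneg[of h n] order_trans[OF zero_le_power2 G_ge] by (intro add_nonneg_nonneg) auto
  have "?w * (P h (Suc n) * W h (Suc n)) = 2 / B * (P h n * ?w) * (?z * W h (Suc n))"
    by (simp add: P_Suc)
  also have "\<dots> \<le> 2 / B * (P h n * ?w) * (?q * ?w + ?g)"
    using * w B P_pos[of h n] by (intro mult_left_mono) auto
  also have "\<dots> \<le> 2 / B * D h n * (?q * ?w + ?g)"
    using Suc B qg by (intro mult_right_mono mult_left_mono) auto
  also have "\<dots> \<le> ?w * D h (Suc n)"
    by (rule W_D_Suc_ge)
  finally show ?case using w by simp
qed

text \<open>The moment bound is available only from level \<open>1\<close> on, so the induction
  starts there. Its base case comes from expanding \<open>D hc 1\<close> explicitly in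
  \<open>Z hc 0\<close>.\<close>

lemma P_hc_1_le: "\<beta> * sqrt \<kappa> ^ Suc 1 * P hc 1 \<le> 1"
proof (rule power2_le_imp_le)
  define z t where "z = Z hc 0" and "t = \<beta>\<^sup>2 * \<kappa>"
  have z: "0 < z" and t: "0 < t"
    using Z_pos \<kappa>_pos \<beta> by (auto simp: z_def t_def)
  have b: "0 < \<beta> * \<kappa>" using \<beta> \<kappa>_pos by simp
  have sq: "sqrt \<kappa> ^ Suc 1 = \<kappa>"
    using \<kappa>_pos by simp
  have "2 / B * z * (z + t * z) \<le> D hc 1"
    using D_Suc_ge[of hc 0] by (simp add: D_0 E_0 a_def z_def t_def)
  then have "\<beta> * \<kappa> * (2 / B * z * (z + t * z)) \<le> 1 / (2 * B)"
    using D_hc_le[of 1] b unfolding sq by (smt (verit) mult_left_mono le_refl)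
  also have "\<beta> * \<kappa> * (2 / B * z * (z + t * z)) = 4 * (\<beta> * \<kappa>) * z\<^sup>2 * (1 + t) / (2 * B)"
    using B by (simp add: power2_eq_square field_simps)
  finally have main: "4 * (\<beta> * \<kappa>) * z\<^sup>2 * (1 + t) \<le> 1"
    using B by (subst (asm) divide_le_cancel) auto
  \<comment> \<open>Trading \<open>1 + t\<close> for a second factor
    \<open>\<beta> * \<kappa>\<close> turns \<open>main\<close> into a bound on a perfect
    square.\<close>
  have "(\<beta> * \<kappa>)\<^sup>2 \<le> (1 + t)\<^sup>2"
  proof -
    have "(\<beta> * \<kappa>)\<^sup>2 = t * \<kappa>" by (simp add: t_def power2_eq_square)
    also have "\<dots> \<le> t * 1" using t \<kappa> by (intro mult_left_mono) auto
    also have "\<dots> \<le> (1 + t)\<^sup>2" using t by (simp add: power2_eq_square algebra_simps)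
    finally show ?thesis .
  qed
  then have "\<beta> * \<kappa> \<le> 1 + t"
    by (rule power2_le_imp_le) (use t in simp)
  then have "4 * (\<beta> * \<kappa>) * z\<^sup>2 * (\<beta> * \<kappa>) \<le> 4 * (\<beta> * \<kappa>) * z\<^sup>2 * (1 + t)"
    using b by (intro mult_left_mono) auto
  with main have "(2 * (\<beta> * \<kappa>) * z)\<^sup>2 \<le> 1"
    by (simp add: power2_eq_square algebra_simps)
  moreover have "1 \<le> B\<^sup>2" using B by simp
  ultimately have "(2 * (\<beta> * \<kappa>) * z)\<^sup>2 \<le> B\<^sup>2" by linarith
  moreover have "\<beta> * sqrt \<kappa> ^ Suc 1 * P hc 1 = 2 * (\<beta> * \<kappa>) * z / B"
    unfolding sq by (simp add: P_def z_def)
  ultimately show "(\<beta> * sqrt \<kappa> ^ Suc 1 * P hc 1)\<^sup>2 \<le> 1\<^sup>2"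
    using B by (simp add: power_divide)
qed simp

text \<open>The value \<open>4 / 5\<close> is matched to the later \<open>5 / 8\<close>, as
  \<open>2 * (4 / 5) * (5 / 8) = 1\<close>.\<close>

lemma sqrt_\<kappa>_le: "sqrt \<kappa> \<le> 4 / 5"
  by (rule real_le_lsqrt) (use \<kappa> in \<open>auto simp: power2_eq_square\<close>)

lemma P_hc_le:
  assumes "n \<ge> 1"
  shows "\<beta> * sqrt \<kappa> ^ Suc n * P hc n \<le> 1"
  using assms
proof (induction n rule: dec_induct)
  case base
  show ?case by (rule P_hc_1_le)
next
  case (step n)
  define T where "T = \<beta> * sqrt \<kappa> ^ Suc n * P hc n"
  have T: "0 \<le> T" "T \<le> 1"
    using step P_pos[of hc n] \<beta> \<kappa>_pos by (auto simp: T_def)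
  have "T * W hc n = \<beta> * sqrt \<kappa> ^ Suc n * (P hc n * W hc n)"
    by (simp add: T_def)
  also have "\<dots> \<le> \<beta> * sqrt \<kappa> ^ Suc n * D hc n"
    using P_W_le_D[OF Z_hc_le_1] \<beta> \<kappa>_pos by (intro mult_left_mono) auto
  also have "\<dots> \<le> 1 / (2 * B)"
    using D_hc_le step by simp
  finally have TW: "T * W hc n \<le> 1 / (2 * B)" .
  \<comment> \<open>The empty part uses the induction hypothesis \<open>T \<le> 1\<close>; the
    nonempty part \<open>TW\<close> used the moment bound.\<close>
  have TQ: "T * Q hc n \<le> 1 * (B - 1)"
    using T Q_le Q_nonneg by (intro mult_mono) auto
  have "(B - 1 + 1 / (2 * B)) / B \<le> 5 / 8"
  proof -
    \<comment> \<open>The claim, cleared of denominators, is exactly this factored quadratic;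
      equality occurs at \<open>B = 2\<close>.\<close>
    have "0 \<le> (2 - B) * (3 * B - 2)" using B by simp
    then show ?thesis using B by (simp add: field_simps power2_eq_square)
  qed
  then have "2 * sqrt \<kappa> * ((B - 1 + 1 / (2 * B)) / B) \<le> 2 * (4 / 5) * (5 / 8)"
    using sqrt_\<kappa>_le \<kappa>_pos B by (intro mult_mono) auto
  then have num: "2 * sqrt \<kappa> / B * (B - 1 + 1 / (2 * B)) \<le> 1"
    by simp
  have "\<beta> * sqrt \<kappa> ^ Suc (Suc n) * P hc (Suc n) = 2 * sqrt \<kappa> / B * (T * Z hc n)"
    by (simp add: P_Suc T_def)
  also have "\<dots> = 2 * sqrt \<kappa> / B * (T * Q hc n + T * W hc n)"
    by (simp add: Z_eq_Q_plus_W distrib_left)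
  also have "\<dots> \<le> 2 * sqrt \<kappa> / B * (B - 1 + 1 / (2 * B))"
    using TW TQ B \<kappa>_pos by (intro mult_left_mono add_mono) auto
  finally show ?case using num by linarith
qed

section \<open>Product bound, failure of convergence, and mean at the critical point\<close>

lemma prod_Z_hc_le:
  assumes "n \<ge> 1"
  shows "(\<Prod>p<n. Z hc p) \<le> 1 / (\<beta> * sqrt \<kappa>) * (B / (2 * sqrt \<kappa>)) ^ n"
proof -
  have c: "0 < \<beta> * sqrt \<kappa> ^ Suc n * (2 / B) ^ n"
    using \<beta> B \<kappa>_pos by simp
  have "(\<Prod>p<n. Z hc p) * (\<beta> * sqrt \<kappa> ^ Suc n * (2 / B) ^ n) \<le> 1"
    using P_hc_le[OF assms] by (simp add: P_def ac_simps)
  then have "(\<Prod>p<n. Z hc p) \<le> 1 / (\<beta> * sqrt \<kappa> ^ Suc n * (2 / B) ^ n)"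
    using c by (simp only: pos_le_divide_eq)
  also have "\<dots> = 1 / (\<beta> * sqrt \<kappa>) * (B / (2 * sqrt \<kappa>)) ^ n"
    by (simp add: power_divide power_mult_distrib)
  finally show ?thesis .
qed

text \<open>Factors tending to \<open>1\<close> would eventually exceed some
  \<open>r > \<rho>\<close>, so their product could not decay like \<open>\<rho> ^ n\<close> with
  \<open>\<rho> < 1\<close>.\<close>

lemma Z_hc_not_tendsto_1: "\<not> (\<lambda>n. Z hc n) \<longlonglongrightarrow> 1"
proof
  assume lim: "(\<lambda>n. Z hc n) \<longlonglongrightarrow> 1"
  define \<rho> where "\<rho> = B / (2 * sqrt \<kappa>)"
  define r where "r = (1 + \<rho>) / 2"
  define C where "C = 1 / (\<beta> * sqrt \<kappa>)"
  have "B / 2 < sqrt \<kappa>"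
    using \<kappa> by (intro real_less_rsqrt) (simp add: power_divide)
  then have \<rho>: "0 < \<rho>" "\<rho> < 1"
    using B \<kappa>_pos by (auto simp: \<rho>_def pos_divide_less_eq)
  then have r: "\<rho> < r" "r < 1" by (auto simp: r_def)
  then obtain N where N: "\<And>n. n \<ge> N \<Longrightarrow> r \<le> Z hc n"
    using order_tendstoD(1)[OF lim, of r] unfolding eventually_sequentially
    by (meson less_imp_le)
  \<comment> \<open>\<open>Suc N\<close> keeps the number of factors at least \<open>1\<close>, as
    the product bound requires.\<close>
  define c where "c = (\<Prod>p<Suc N. Z hc p)"
  have c: "0 < c" unfolding c_def by (intro prod_pos) (auto simp: Z_pos)
  have lower: "c * r ^ k \<le> (\<Prod>p<Suc N + k. Z hc p)" for k
  proof (induction k)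
    case (Suc k)
    have "c * r ^ k * r \<le> (\<Prod>p<Suc N + k. Z hc p) * Z hc (Suc N + k)"
      using Suc N[of "Suc N + k"] c \<rho> r by (intro mult_mono prod_nonneg) (auto simp: Z_pos less_imp_le)
    then show ?case by (simp add: mult.assoc mult.commute[of r])
  qed (simp add: c_def)
  obtain k where k: "C * \<rho> ^ Suc N / c < (r / \<rho>) ^ k"
    using real_arch_pow[of "r / \<rho>"] r \<rho> by auto
  have "c * r ^ k \<le> C * \<rho> ^ (Suc N + k)"
    using lower[of k] prod_Z_hc_le[of "Suc N + k"] unfolding C_def \<rho>_def by linarith
  then have "c * r ^ k \<le> C * \<rho> ^ Suc N * \<rho> ^ k"
    by (simp only: power_add mult.assoc)
  moreover have "C * \<rho> ^ Suc N * \<rho> ^ k < (r / \<rho>) ^ k * c * \<rho> ^ k"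
    using k c \<rho> by (intro mult_strict_right_mono) (simp_all only: pos_divide_less_eq zero_less_power)
  moreover have "(r / \<rho>) ^ k * c * \<rho> ^ k = c * r ^ k"
    using \<rho> by (simp add: power_divide)
  ultimately show False by linarith
qed

text \<open>For \<open>n \<ge> 1\<close> the normalisation is at least \<open>(B - 1) / B\<close>,
  which turns the constant \<open>1 / (2 * B)\<close> into \<open>1 / (2 * (B - 1))\<close>.\<close>

lemma mean_S_hc_le:
  assumes n: "n \<ge> 1"
  shows "D hc n / Z hc n \<le> (1 / (2 * (B - 1))) / \<beta> * (1 / \<kappa> powr ((real n + 1) / 2))"
proof -
  have s: "sqrt \<kappa> ^ Suc n = \<kappa> powr ((real n + 1) / 2)"
  proof -
    have "sqrt \<kappa> ^ Suc n = sqrt \<kappa> powr real (Suc n)"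
      using \<kappa>_pos by (intro powr_realpow[symmetric]) simp
    also have "\<dots> = (\<kappa> powr (1 / 2)) powr real (Suc n)"
      using \<kappa>_pos by (simp only: powr_half_sqrt less_imp_le)
    also have "(\<kappa> powr (1 / 2)) powr real (Suc n) = \<kappa> powr (1 / 2 * real (Suc n))"
      by (rule powr_powr)
    also have "1 / 2 * real (Suc n) = (real n + 1) / 2" by simp
    finally show ?thesis .
  qed
  have pos: "0 < \<beta> * sqrt \<kappa> ^ Suc n" using \<beta> \<kappa>_pos by simp
  have "D hc n \<le> 1 / (2 * B) / (\<beta> * sqrt \<kappa> ^ Suc n)"
    using D_hc_le[OF n] pos by (simp only: pos_le_divide_eq mult.commute)
  moreover have "(B - 1) / B \<le> Z hc n"
    using Q_ge[OF n, of hc] W_pos[of hc n] by (simp add: Z_eq_Q_plus_W)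
  ultimately have "D hc n / Z hc n \<le> 1 / (2 * B) / (\<beta> * sqrt \<kappa> ^ Suc n) / ((B - 1) / B)"
    using B pos by (intro frac_le) auto
  also have "\<dots> = (1 / (2 * (B - 1))) / \<beta> * (1 / sqrt \<kappa> ^ Suc n)"
    using B by (simp del: power_Suc)
  finally show ?thesis unfolding s .
qed

end

theorem theorem3p6:
  fixes B :: real
  assumes "1 < B" and "B < 2"
  shows "\<exists>c::real. \<forall>\<kappa> \<beta>. B\<^sup>2 / 4 < \<kappa> \<and> \<kappa> < 1 / 2 \<and> \<beta> > 0 \<longrightarrow>
    \<not> (\<lambda>n. ann_Z B \<kappa> \<beta> (ann_hc B \<kappa> \<beta>) n) \<longlonglongrightarrow> 1 \<and>
    (\<forall>n\<ge>1. (\<Prod>p<n. ann_Z B \<kappa> \<beta> (ann_hc B \<kappa> \<beta>) p)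
       \<le> 1 / (\<beta> * sqrt \<kappa>) * (B / (2 * sqrt \<kappa>)) ^ n) \<and>
    (\<forall>n\<ge>1. ann_E B \<kappa> \<beta> (ann_hc B \<kappa> \<beta>) n (hier_S n)
       \<le> c / \<beta> * (1 / \<kappa> powr ((real n + 1) / 2)))"
proof (intro exI[of _ "1 / (2 * (B - 1))"] allI impI, elim conjE)
  fix \<kappa> \<beta> :: real
  assume "B\<^sup>2 / 4 < \<kappa>" "\<kappa> < 1 / 2" "\<beta> > 0"
  with assms interpret hier_pinning B \<kappa> \<beta> by unfold_locales
  have mean: "ann_E B \<kappa> \<beta> hc n (hier_S n) = D hc n / Z hc n" for n
    unfolding ann_E_hier_S ann_Z_eq D_def ..
  show "\<not> (\<lambda>n. ann_Z B \<kappa> \<beta> (ann_hc B \<kappa> \<beta>) n) \<longlonglongrightarrow> 1 \<and>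
    (\<forall>n\<ge>1. (\<Prod>p<n. ann_Z B \<kappa> \<beta> (ann_hc B \<kappa> \<beta>) p)
       \<le> 1 / (\<beta> * sqrt \<kappa>) * (B / (2 * sqrt \<kappa>)) ^ n) \<and>
    (\<forall>n\<ge>1. ann_E B \<kappa> \<beta> (ann_hc B \<kappa> \<beta>) n (hier_S n)
       \<le> 1 / (2 * (B - 1)) / \<beta> * (1 / \<kappa> powr ((real n + 1) / 2)))"
    unfolding mean ann_Z_eq using Z_hc_not_tendsto_1 prod_Z_hc_le mean_S_hc_le by blast
qed

end
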